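(* Let $G$ be a simple graph with vertex set $V(G)=\{v_1,\dots,v_n\}$ and $m$ edges, let $S\subseteq V(G)$ with $|S|=\sigma$, and let $G_S$ be the graph obtained from $G$ by attaching one self-loop at each vertex of $S$. Let $\lambda_1\ge\dots\ge\lambda_n$ be the adjacency eigenvalues of $G_S$. Then $$\lambda_1(G_S)\le\sqrt{2m+\sigma},$$ with equality if and only if $G_S=\widehat{K_\sigma}\cup(n-\sigma)K_1$. Moreover, if $G_S$ is connected, equality holds if and only if $G_S=\widehat{K_n}$.
   Context: The adjacency matrix $A(G_S)=[a_{ij}]$ is the $n\times n$ symmetric $0/1$ matrix with, for $i\ne j$, $a_{ij}=1$ iff $v_i,v_j$ are adjacent, and $a_{ii}=1$ iff $v_i\in S$; its eigenvalues are the adjacency eigenvalues of $G_S$. Here $m$ counts only edges of $G$ (not loops). $\widehat{K_k}$ denotes the complete graph $K_k$ with a self-loop at each vertex, and $(n-\sigma)K_1$ denotes $n-\sigma$ isolated vertices without loops.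
   Formalization: In the final claim on connected G_S, the single case n = 1, σ = 0 is excluded: one vertex without a loop is connected and has λ₁ = 0 = √(2m+σ), but it is not K_1 with a self-loop, so the claim is false there. *)

theory Defs
  imports Complex_Main "Jordan_Normal_Form.Char_Poly"
begin

record 'a loop_graph =
  verts :: "'a set"
  edges :: "'a set set"
  loops :: "'a set"

definition simple_graph :: "'a set \<Rightarrow> 'a set set \<Rightarrow> bool" where
  "simple_graph V E \<longleftrightarrow> finite V \<and> (\<forall>e\<in>E. e \<subseteq> V \<and> card e = 2)"

definition attach_loops :: "'a set \<Rightarrow> 'a set set \<Rightarrow> 'a set \<Rightarrow> 'a loop_graph" where
  "attach_loops V E S = \<lparr>verts = V, edges = E, loops = S\<rparr>"

definition loop_graph_connected :: "'a loop_graph \<Rightarrow> bool" where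
  "loop_graph_connected H \<longleftrightarrow>
     verts H \<noteq> {} \<and>
     (\<forall>u\<in>verts H. \<forall>w\<in>verts H. (u, w) \<in> {(x, y). {x, y} \<in> edges H}\<^sup>*)"

definition loop_graph_iso :: "'a loop_graph \<Rightarrow> 'b loop_graph \<Rightarrow> bool" (infix "\<cong>\<^sub>l" 50) where
  "H \<cong>\<^sub>l H' \<longleftrightarrow>
     (\<exists>f. bij_betw f (verts H) (verts H') \<and>
          edges H' = (\<lambda>e. f ` e) ` edges H \<and>
          loops H' = f ` loops H)"

definition looped_complete :: "nat \<Rightarrow> nat loop_graph" where
  "looped_complete k =
     \<lparr>verts = {..<k}, edges = {e. e \<subseteq> {..<k} \<and> card e = 2}, loops = {..<k}\<rparr>"

definition isolated_vertices :: "nat \<Rightarrow> nat loop_graph" where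
  "isolated_vertices k = \<lparr>verts = {..<k}, edges = {}, loops = {}\<rparr>"

definition loop_graph_union :: "'a loop_graph \<Rightarrow> 'b loop_graph \<Rightarrow> ('a + 'b) loop_graph"
    (infixl "\<union>\<^sub>l" 65) where
  "H \<union>\<^sub>l H' =
     \<lparr>verts = verts H <+> verts H',
      edges = (\<lambda>e. Inl ` e) ` edges H \<union> (\<lambda>e. Inr ` e) ` edges H',
      loops = loops H <+> loops H'\<rparr>"

(* The list vs is an enumeration v_1, ..., v_n of the vertices, with v_i = vs ! (i - 1). *)
definition adj_matrix :: "'a list \<Rightarrow> 'a loop_graph \<Rightarrow> real mat" where
  "adj_matrix vs H = mat (length vs) (length vs) (\<lambda>(i, j).
     if i = j then of_bool (vs ! i \<in> loops H)
     else of_bool ({vs ! i, vs ! j} \<in> edges H))"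

(* The matrix is real symmetric, so its characteristic polynomial splits over the reals and
   the multiset of its real roots consists of all n eigenvalues with multiplicity. *)
definition adj_spectrum :: "'a list \<Rightarrow> 'a loop_graph \<Rightarrow> real list" where
  "adj_spectrum vs H = rev (sorted_list_of_multiset (proots (char_poly (adj_matrix vs H))))"

(* Decreasing order, indices starting at 1. *)
definition adj_eigenvalue :: "'a list \<Rightarrow> 'a loop_graph \<Rightarrow> nat \<Rightarrow> real" where
  "adj_eigenvalue vs H i = adj_spectrum vs H ! (i - 1)"

end

theory Submission
  imports Defs "Jordan_Normal_Form.Spectral_Radius"
begin

text \<open>
  If \<open>A x = r x\<close> for a real symmetric matrix \<open>A\<close> and \<open>t = r / \<bar>x\<bar>\<^sup>2\<close>, then expanding the square gives
  \<open>\<Sum> (A\<^sub>u\<^sub>v - t x\<^sub>u x\<^sub>v)\<^sup>2 = \<Sum> A\<^sub>u\<^sub>v\<^sup>2 - r\<^sup>2\<close>. For a graph with loops the right-hand side is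
  \<open>2 m + \<sigma> - r\<^sup>2\<close>, which is the bound. In the case of equality \<open>A\<^sub>u\<^sub>v = t x\<^sub>u x\<^sub>v\<close>, so that an entry
  \<open>A\<^sub>u\<^sub>v\<close> is nonzero iff both diagonal entries \<open>A\<^sub>u\<^sub>u\<close> and \<open>A\<^sub>v\<^sub>v\<close> are: the edges are exactly the pairs
  of looped vertices. Conversely, for such a graph the indicator function of the loops is an
  eigenvector for \<open>\<sigma> = sqrt (2 m + \<sigma>)\<close>.
\<close>

section \<open>Eigenvectors as functions on the vertex set; real eigenvalues of symmetric
  matrices\<close>

lemma sum_nth_distinct:
  assumes "distinct vs"
  shows "(\<Sum>i<length vs. f (vs ! i)) = (\<Sum>v\<in>set vs. f v)"
  using sum.reindex_bij_betw[OF bij_betw_nth[OF assms refl refl], of f] by simp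

text \<open>Passing from positions in \<open>vs\<close> to vertices lets all later sums range over a
  set. The field is left general because both the real matrix and its complexification need this
  translation.\<close>

lemma eigenvalue_mat_list_iff:
  fixes a :: "'a \<Rightarrow> 'a \<Rightarrow> 'b :: field"
  assumes "distinct vs"
  shows "eigenvalue (mat (length vs) (length vs) (\<lambda>(i, j). a (vs ! i) (vs ! j))) k \<longleftrightarrow>
    (\<exists>x. (\<exists>u\<in>set vs. x u \<noteq> 0) \<and> (\<forall>u\<in>set vs. (\<Sum>v\<in>set vs. a u v * x v) = k * x u))"
    (is "eigenvalue ?A k \<longleftrightarrow> ?R")
proof
  assume "eigenvalue ?A k"
  then obtain w where w: "w \<in> carrier_vec (length vs)" "w \<noteq> 0\<^sub>v (length vs)" "?A *\<^sub>v w = k \<cdot>\<^sub>v w"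
    unfolding eigenvalue_def eigenvector_def by auto
  \<comment> \<open>The coordinates of \<open>w\<close> are transported along the inverse of the
    enumeration, which exists on \<open>set vs\<close> because \<open>vs\<close> is
    distinct.\<close>
  define x where "x = (\<lambda>u. w $ the_inv_into {..<length vs} ((!) vs) u)"
  have x: "x (vs ! i) = w $ i" if "i < length vs" for i
    using that assms unfolding x_def
    by (subst the_inv_into_f_f) (auto simp: inj_on_def nth_eq_iff_index_eq)
  have 1: "\<exists>u\<in>set vs. x u \<noteq> 0"
    using w(1,2) x by (metis carrier_vecD eq_vecI index_zero_vec(1,2) nth_mem)
  have "(\<Sum>v\<in>set vs. a u v * x v) = k * x u" if u: "u \<in> set vs" for u
  proof -
    obtain i where i: "i < length vs" "u = vs ! i" using u by (metis in_set_conv_nth)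
    have "(?A *\<^sub>v w) $ i = (\<Sum>j<length vs. a u (vs ! j) * x (vs ! j))"
      using i w(1) x by (auto simp: scalar_prod_def atLeast0LessThan intro!: sum.cong)
    also have "\<dots> = (\<Sum>v\<in>set vs. a u v * x v)" by (rule sum_nth_distinct[OF assms])
    finally show ?thesis using i w x by auto
  qed
  with 1 show ?R by blast
next
  assume ?R
  then obtain x where x: "\<exists>u\<in>set vs. x u \<noteq> 0"
    "\<And>u. u \<in> set vs \<Longrightarrow> (\<Sum>v\<in>set vs. a u v * x v) = k * x u" by blast
  define w where "w = vec (length vs) (\<lambda>i. x (vs ! i))"
  obtain i where i: "i < length vs" "x (vs ! i) \<noteq> 0" using x(1) by (metis in_set_conv_nth)
  have "w \<noteq> 0\<^sub>v (length vs)"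
  proof
    assume "w = 0\<^sub>v (length vs)"
    then have "w $ i = 0" using i by simp
    with i show False by (simp add: w_def)
  qed
  moreover have "?A *\<^sub>v w = k \<cdot>\<^sub>v w"
  proof (rule eq_vecI)
    fix i assume "i < dim_vec (k \<cdot>\<^sub>v w)"
    then have i: "i < length vs" by (simp add: w_def)
    have "(?A *\<^sub>v w) $ i = (\<Sum>j<length vs. a (vs ! i) (vs ! j) * x (vs ! j))"
      using i by (auto simp: scalar_prod_def w_def atLeast0LessThan intro!: sum.cong)
    also have "\<dots> = k * x (vs ! i)"
      by (rule trans[OF sum_nth_distinct[OF assms, of "\<lambda>v. a (vs ! i) v * x v"] x(2)[OF nth_mem[OF i]]])
    finally show "(?A *\<^sub>v w) $ i = (k \<cdot>\<^sub>v w) $ i" using i by (simp add: w_def)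
  qed (simp add: w_def)
  ultimately show "eigenvalue ?A k"
    unfolding eigenvalue_def eigenvector_def by (intro exI[of _ w]) (simp add: w_def)
qed

text \<open>A complex eigenvalue exists since the spectrum of a nonempty complex matrix is nonempty;
  symmetry makes it real, and it is then a root of the real characteristic polynomial. One
  eigenvalue suffices to make the spectrum list nonempty, so that its head is meaningful.\<close>

lemma symmetric_real_eigenvalue_ex:
  fixes a :: "'a \<Rightarrow> 'a \<Rightarrow> real"
  assumes "distinct vs" "vs \<noteq> []"
    and sym: "\<And>u v. u \<in> set vs \<Longrightarrow> v \<in> set vs \<Longrightarrow> a u v = a v u"
  shows "\<exists>r. eigenvalue (mat (length vs) (length vs) (\<lambda>(i, j). a (vs ! i) (vs ! j))) r"
    (is "\<exists>r. eigenvalue ?A r")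
proof -
  define C where
    "C = mat (length vs) (length vs) (\<lambda>(i, j). complex_of_real (a (vs ! i) (vs ! j)))"
  have A: "?A \<in> carrier_mat (length vs) (length vs)" by simp
  have C: "C \<in> carrier_mat (length vs) (length vs)" by (simp add: C_def)
  have C_map: "C = map_mat complex_of_real ?A" unfolding C_def by (rule eq_matI) auto
  obtain z where z: "eigenvalue C z"
    using spectrum_non_empty[OF C] assms(2) unfolding spectrum_def by auto
  obtain x where x: "\<exists>u\<in>set vs. x u \<noteq> 0"
    "\<And>u. u \<in> set vs \<Longrightarrow> (\<Sum>v\<in>set vs. complex_of_real (a u v) * x v) = z * x u"
    using z eigenvalue_mat_list_iff[OF assms(1), of "\<lambda>u v. complex_of_real (a u v)" z]
    unfolding C_def by auto
  define N where "N = (\<Sum>u\<in>set vs. cnj (x u) * x u)"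
  have N_real: "N = complex_of_real (\<Sum>u\<in>set vs. (cmod (x u))\<^sup>2)"
    unfolding N_def by (simp only: of_real_sum complex_norm_square mult.commute)
  have "(\<Sum>u\<in>set vs. (cmod (x u))\<^sup>2) \<noteq> 0"
    using x(1) by (subst sum_nonneg_eq_0_iff) auto
  then have N0: "N \<noteq> 0" unfolding N_real of_real_eq_0_iff .
  \<comment> \<open>\<open>z * N\<close> is the value at \<open>x\<close> of the Hermitian form
    given by \<open>a\<close>.\<close>
  have q: "z * N = (\<Sum>u\<in>set vs. \<Sum>v\<in>set vs. complex_of_real (a u v) * cnj (x u) * x v)"
  proof -
    have "z * N = (\<Sum>u\<in>set vs. cnj (x u) * (z * x u))"
      unfolding N_def sum_distrib_left by (simp add: algebra_simps)
    also have "\<dots> = (\<Sum>u\<in>set vs. cnj (x u) * (\<Sum>v\<in>set vs. complex_of_real (a u v) * x v))"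
      using x(2) by simp
    finally show ?thesis by (simp add: sum_distrib_left algebra_simps)
  qed
  \<comment> \<open>Conjugation exchanges the roles of \<open>u\<close> and \<open>v\<close> in the
    form; swapping the sums and using symmetry restores it, so the form takes a real value.\<close>
  have "cnj (z * N) = (\<Sum>u\<in>set vs. \<Sum>v\<in>set vs. complex_of_real (a u v) * cnj (x v) * x u)"
    unfolding q by (simp add: algebra_simps)
  also have "\<dots> = (\<Sum>v\<in>set vs. \<Sum>u\<in>set vs. complex_of_real (a u v) * cnj (x v) * x u)"
    by (rule sum.swap)
  also have "\<dots> = z * N" unfolding q using sym by (intro sum.cong) auto
  finally have "cnj z * N = z * N" by (simp add: N_real)
  then have "cnj z = z" using N0 by simp
  then have zr: "z = complex_of_real (Re z)" by (metis Reals_cnj_iff of_real_Re)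
  \<comment> \<open>The characteristic polynomial of \<open>C\<close> is the image of the real one,
    and the embedding of the reals reflects zeros.\<close>
  have "poly (map_poly complex_of_real (char_poly ?A)) (complex_of_real (Re z)) = 0"
    using z unfolding eigenvalue_root_char_poly[OF C] zr[symmetric]
    unfolding C_map of_real_hom.char_poly_hom[OF A] .
  then have "poly (char_poly ?A) (Re z) = 0"
    by simp
  then show ?thesis using eigenvalue_root_char_poly[OF A] by blast
qed

section \<open>Distance from a matrix to a multiple of the square of an eigenvector\<close>

lemma rank_one_approximation:
  fixes a :: "'a \<Rightarrow> 'a \<Rightarrow> real"
  assumes "finite V" "\<exists>u\<in>V. x u \<noteq> 0"
    and ev: "\<And>u. u \<in> V \<Longrightarrow> (\<Sum>v\<in>V. a u v * x v) = r * x u"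
  shows "\<exists>t. (\<Sum>u\<in>V. \<Sum>v\<in>V. (a u v - t * x u * x v)\<^sup>2) = (\<Sum>u\<in>V. \<Sum>v\<in>V. (a u v)\<^sup>2) - r\<^sup>2"
proof -
  define N where "N = (\<Sum>u\<in>V. (x u)\<^sup>2)"
  \<comment> \<open>This is the least-squares coefficient: the inner product of \<open>a\<close>
    with the matrix of entries \<open>x u * x v\<close> is \<open>r * N\<close>, and the squared
    norm of that matrix is \<open>N\<close> squared.\<close>
  define t where "t = r / N"
  have "N \<noteq> 0" unfolding N_def using assms(1,2) by (subst sum_nonneg_eq_0_iff) auto
  then have tN: "t * N = r" by (simp add: t_def)
  have cross: "(\<Sum>u\<in>V. \<Sum>v\<in>V. a u v * x u * x v) = r * N"
  proof -
    have "(\<Sum>u\<in>V. \<Sum>v\<in>V. a u v * x u * x v) = (\<Sum>u\<in>V. x u * (\<Sum>v\<in>V. a u v * x v))"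
      by (simp add: sum_distrib_left algebra_simps)
    also have "\<dots> = (\<Sum>u\<in>V. r * (x u)\<^sup>2)"
      using ev by (intro sum.cong) (auto simp: power2_eq_square)
    finally show ?thesis by (simp add: N_def sum_distrib_left)
  qed
  have sq: "(\<Sum>u\<in>V. (x u)\<^sup>2 * (\<Sum>v\<in>V. (x v)\<^sup>2)) = N\<^sup>2"
    unfolding N_def by (simp add: power2_eq_square sum_distrib_right)
  have "(\<Sum>u\<in>V. \<Sum>v\<in>V. (a u v - t * x u * x v)\<^sup>2) =
      (\<Sum>u\<in>V. \<Sum>v\<in>V. (a u v)\<^sup>2 - 2 * t * (a u v * x u * x v) + t\<^sup>2 * ((x u)\<^sup>2 * (x v)\<^sup>2))"
    by (simp add: power2_eq_square algebra_simps)
  also have "\<dots> = (\<Sum>u\<in>V. \<Sum>v\<in>V. (a u v)\<^sup>2) - 2 * t * (r * N) + t\<^sup>2 * N\<^sup>2"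
    by (simp only: sum.distrib sum_subtractf sum_distrib_left[symmetric] cross sq)
  also have "\<dots> = (\<Sum>u\<in>V. \<Sum>v\<in>V. (a u v)\<^sup>2) - 2 * r * (t * N) + (t * N)\<^sup>2"
    by (simp add: power_mult_distrib)
  also have "\<dots> = (\<Sum>u\<in>V. \<Sum>v\<in>V. (a u v)\<^sup>2) - r\<^sup>2"
    unfolding tN by (simp add: power2_eq_square)
  finally show ?thesis by blast
qed

section \<open>Adjacency entries and their sum\<close>

definition adj :: "'a set set \<Rightarrow> 'a set \<Rightarrow> 'a \<Rightarrow> 'a \<Rightarrow> real" where
  "adj E S u v = (if u = v then of_bool (u \<in> S) else of_bool ({u, v} \<in> E))"

lemma adj_commute: "adj E S u v = adj E S v u"
  by (simp add: adj_def insert_commute)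

text \<open>This turns the sum of squares in the rank-one identity into a count of edges and
  loops.\<close>

lemma adj_square: "(adj E S u v)\<^sup>2 = adj E S u v"
  by (simp add: adj_def)

lemma adj_matrix_attach_loops:
  assumes "distinct vs"
  shows "adj_matrix vs (attach_loops V E S) =
    mat (length vs) (length vs) (\<lambda>(i, j). adj E S (vs ! i) (vs ! j))"
  unfolding adj_matrix_def attach_loops_def adj_def
  \<comment> \<open>The two sides test equality of positions and equality of vertices respectively;
    distinctness of \<open>vs\<close> identifies these tests.\<close>
  by (rule eq_matI) (auto simp: nth_eq_iff_index_eq[OF assms])

text \<open>Double counting: an edge accounts for two ordered pairs of vertices, a loop for a single
  diagonal entry.\<close>

lemma sum_adj:
  assumes "simple_graph V E" "S \<subseteq> V"
  shows "(\<Sum>u\<in>V. \<Sum>v\<in>V. adj E S u v) = 2 * real (card E) + real (card S)"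
proof -
  have fin: "finite V" and E: "\<And>e. e \<in> E \<Longrightarrow> e \<subseteq> V \<and> card e = 2"
    using assms(1) by (auto simp: simple_graph_def)
  have "E \<subseteq> Pow V" using E by auto
  then have finE: "finite E" using fin by (meson finite_Pow_iff finite_subset)
  \<comment> \<open>\<open>P e\<close> collects the two orderings of the endpoints of
    \<open>e\<close>; these sets are disjoint for different edges.\<close>
  define P where "P = (\<lambda>e. {p. e = {fst p, snd p :: 'a}})"
  have card_P: "card (P e) = 2" "finite (P e)" if "e \<in> E" for e
  proof -
    have "card e = 2" using E \<open>e \<in> E\<close> by blast
    then obtain u v where uv: "e = {u, v}" "u \<noteq> v" by (auto simp: card_2_iff)
    then have "P e = {(u, v), (v, u)}" unfolding P_def by (auto simp: doubleton_eq_iff)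
    then show "card (P e) = 2" "finite (P e)" using uv by auto
  qed
  have "card (\<Union>e\<in>E. P e) = (\<Sum>e\<in>E. card (P e))"
    using finE card_P by (intro card_UN_disjoint) (auto simp: P_def)
  also have "\<dots> = 2 * card E" using card_P by simp
  finally have card_UN: "card (\<Union>e\<in>E. P e) = 2 * card E" .
  \<comment> \<open>No edge is a singleton, so the edge term vanishes on the diagonal and
    \<open>adj\<close> splits additively into an edge part and a loop part.\<close>
  have neq: "{u} \<notin> E" for u using E[of "{u}"] by auto
  have UN: "(\<Union>e\<in>E. P e) = {p \<in> V \<times> V. {fst p, snd p} \<in> E}"
    unfolding P_def using \<open>E \<subseteq> Pow V\<close> by auto
  have split: "adj E S u v = of_bool ({u, v} \<in> E) + of_bool (u = v) * of_bool (u \<in> S)" for u v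
    using neq by (simp add: adj_def)
  have "(\<Sum>u\<in>V. \<Sum>v\<in>V. adj E S u v) =
      (\<Sum>u\<in>V. \<Sum>v\<in>V. of_bool ({u, v} \<in> E)) + (\<Sum>u\<in>V. of_bool (u \<in> S))"
    unfolding split sum.distrib sum_distrib_right[symmetric] using fin by simp
  also have "(\<Sum>u\<in>V. of_bool (u \<in> S)) = real (card S)"
    using fin assms(2) by (simp add: Int_absorb1)
  also have "(\<Sum>u\<in>V. \<Sum>v\<in>V. of_bool ({u, v} \<in> E)) =
      (\<Sum>p\<in>V \<times> V. of_bool ({fst p, snd p} \<in> E) :: real)"
    by (simp only: sum.cartesian_product case_prod_unfold)
  also have "\<dots> = real (card (V \<times> V \<inter> {p. {fst p, snd p} \<in> E}))"
    using fin by (intro sum_of_bool_eq finite_cartesian_product)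
  also have "\<dots> = 2 * real (card E)" using card_UN unfolding UN Collect_conj_eq by simp
  finally show ?thesis .
qed

section \<open>The largest eigenvalue and the bound on it\<close>

lemma adj_eigenvalue_1_Max:
  assumes "\<exists>r. eigenvalue (adj_matrix vs H) r"
  shows "eigenvalue (adj_matrix vs H) (adj_eigenvalue vs H 1)"
    and "eigenvalue (adj_matrix vs H) r \<Longrightarrow> r \<le> adj_eigenvalue vs H 1"
proof -
  let ?p = "char_poly (adj_matrix vs H)"
  define l where "l = sorted_list_of_multiset (proots ?p)"
  have A: "adj_matrix vs H \<in> carrier_mat (length vs) (length vs)" by (simp add: adj_matrix_def)
  have "?p \<noteq> 0" using degree_monic_char_poly[OF A] by auto
  then have set_l: "set l = {r. eigenvalue (adj_matrix vs H) r}"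
    unfolding eigenvalue_root_char_poly[OF A] by (simp add: l_def)
  have ne: "l \<noteq> []" using assms set_l by auto
  \<comment> \<open>Index 1 means position 0 of the reversed ascending list, hence the last entry of
    \<open>l\<close>; this needs \<open>l\<close> to be nonempty.\<close>
  have last: "adj_eigenvalue vs H 1 = last l"
    using ne unfolding adj_eigenvalue_def adj_spectrum_def l_def[symmetric]
    by (simp add: hd_conv_nth[symmetric] hd_rev)
  show "eigenvalue (adj_matrix vs H) (adj_eigenvalue vs H 1)"
    using last_in_set[OF ne] set_l last by auto
  have sorted: "sorted l" by (simp add: l_def)
  show "r \<le> adj_eigenvalue vs H 1" if "eigenvalue (adj_matrix vs H) r"
  proof -
    have "r \<in> set l" using that set_l by simp
    then obtain i where "i < length l" "r = l ! i" by (metis in_set_conv_nth)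
    then show ?thesis unfolding last last_conv_nth[OF ne] using sorted
      by (auto intro: sorted_nth_mono)
  qed
qed

lemma eigenvalue_attach_loops_square_bound:
  assumes "simple_graph V E" "S \<subseteq> V" "distinct vs" "set vs = V"
    and "eigenvalue (adj_matrix vs (attach_loops V E S)) r"
  shows "r\<^sup>2 \<le> 2 * real (card E) + real (card S)"
    and "r\<^sup>2 = 2 * real (card E) + real (card S) \<Longrightarrow> E = {e. e \<subseteq> S \<and> card e = 2}"
proof -
  have fin: "finite V" and E: "\<And>e. e \<in> E \<Longrightarrow> e \<subseteq> V \<and> card e = 2"
    using assms(1) by (auto simp: simple_graph_def)
  obtain x where "\<exists>u\<in>V. x u \<noteq> 0" "\<And>u. u \<in> V \<Longrightarrow> (\<Sum>v\<in>V. adj E S u v * x v) = r * x u"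
    using assms(5) unfolding adj_matrix_attach_loops[OF assms(3)]
      eigenvalue_mat_list_iff[OF assms(3)] assms(4) by blast
  from rank_one_approximation[OF fin this] obtain t where
    t: "(\<Sum>u\<in>V. \<Sum>v\<in>V. (adj E S u v - t * x u * x v)\<^sup>2) = 2 * real (card E) + real (card S) - r\<^sup>2"
    unfolding adj_square sum_adj[OF assms(1,2)] by blast
  have "0 \<le> (\<Sum>u\<in>V. \<Sum>v\<in>V. (adj E S u v - t * x u * x v)\<^sup>2)" by (intro sum_nonneg) simp
  with t show "r\<^sup>2 \<le> 2 * real (card E) + real (card S)" by simp
  assume "r\<^sup>2 = 2 * real (card E) + real (card S)"
  with t have "(\<Sum>u\<in>V. \<Sum>v\<in>V. (adj E S u v - t * x u * x v)\<^sup>2) = 0" by simp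
  then have a: "adj E S u v = t * x u * x v" if "u \<in> V" "v \<in> V" for u v
    using that fin by (simp add: sum_nonneg_eq_0_iff sum_nonneg)
  have key: "{u, v} \<in> E \<longleftrightarrow> u \<in> S \<and> v \<in> S" if "u \<in> V" "v \<in> V" "u \<noteq> v" for u v
  proof -
    have "{u, v} \<in> E \<longleftrightarrow> adj E S u v \<noteq> 0" using that by (simp add: adj_def)
    \<comment> \<open>By \<open>a\<close>, the left side says that \<open>t\<close>,
      \<open>x u\<close> and \<open>x v\<close> are all nonzero, and so does the right side.\<close>
    also have "\<dots> \<longleftrightarrow> adj E S u u \<noteq> 0 \<and> adj E S v v \<noteq> 0" using a that by auto
    also have "\<dots> \<longleftrightarrow> u \<in> S \<and> v \<in> S" by (simp add: adj_def)
    finally show ?thesis .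
  qed
  show "E = {e. e \<subseteq> S \<and> card e = 2}"
  proof (intro equalityI subsetI)
    fix e assume "e \<in> E"
    moreover from E[OF this] obtain u v where "e = {u, v}" "u \<noteq> v" "u \<in> V" "v \<in> V"
      by (auto simp: card_2_iff)
    ultimately show "e \<in> {e. e \<subseteq> S \<and> card e = 2}" using key by auto
  next
    fix e assume e: "e \<in> {e. e \<subseteq> S \<and> card e = 2}"
    then obtain u v where "e = {u, v}" "u \<noteq> v" "u \<in> S" "v \<in> S"
      by (auto simp: card_2_iff)
    with assms(2) show "e \<in> E" using key by blast
  qed
qed

section \<open>The extremal graphs attain the bound\<close>

text \<open>Here the adjacency matrix is the outer product of the indicator of \<open>S\<close> with
  itself, so its entries sum to a square. The bound thereby becomes the number of loops.\<close>

lemma complete_part_card_loops: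
  assumes "simple_graph V E" "S \<subseteq> V" "E = {e. e \<subseteq> S \<and> card e = 2}"
  shows "2 * real (card E) + real (card S) = (real (card S))\<^sup>2"
proof -
  have fin: "finite V" using assms(1) by (simp add: simple_graph_def)
  have a: "adj E S u v = of_bool (u \<in> S) * of_bool (v \<in> S)" for u v
    by (auto simp: adj_def assms(3))
  have "(\<Sum>u\<in>V. \<Sum>v\<in>V. adj E S u v) = (real (card S))\<^sup>2"
    unfolding a sum_product[symmetric] using fin assms(2) by (simp add: Int_absorb1 power2_eq_square)
  then show ?thesis using sum_adj[OF assms(1,2)] by simp
qed

text \<open>The indicator of \<open>S\<close> is an eigenvector of its own outer product; it is
  nonzero because \<open>S\<close> is nonempty.\<close>

lemma complete_part_eigenvalue:
  assumes "simple_graph V E" "S \<subseteq> V" "E = {e. e \<subseteq> S \<and> card e = 2}" "S \<noteq> {}"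
    and "distinct vs" "set vs = V"
  shows "eigenvalue (adj_matrix vs (attach_loops V E S)) (real (card S))"
proof -
  have fin: "finite V" using assms(1) by (simp add: simple_graph_def)
  have a: "adj E S u v = of_bool (u \<in> S) * of_bool (v \<in> S)" for u v
    by (auto simp: adj_def assms(3))
  have "(\<Sum>v\<in>V. adj E S u v * of_bool (v \<in> S)) = real (card S) * of_bool (u \<in> S)" for u
  proof -
    have "(\<Sum>v\<in>V. adj E S u v * of_bool (v \<in> S)) = (\<Sum>v\<in>V. of_bool (u \<in> S) * of_bool (v \<in> S))"
      unfolding a by (intro sum.cong) auto
    then show ?thesis using fin assms(2) by (simp add: sum_distrib_left[symmetric] Int_absorb1)
  qed
  moreover have "\<exists>u\<in>V. of_bool (u \<in> S) \<noteq> (0 :: real)" using assms(2,4) by auto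
  ultimately show ?thesis
    unfolding adj_matrix_attach_loops[OF assms(5)] eigenvalue_mat_list_iff[OF assms(5)] assms(6)
    by (intro exI[of _ "\<lambda>v. of_bool (v \<in> S)"]) blast
qed

section \<open>Isomorphism with the extremal graphs, expressed by edge and loop sets\<close>

lemma image_pairs:
  assumes "inj_on f S"
  shows "(`) f ` {e. e \<subseteq> S \<and> card e = 2} = {e. e \<subseteq> f ` S \<and> card e = 2}"
proof -
  have card: "card (f ` d) = card d" if "d \<subseteq> S" for d
    by (rule card_image[OF inj_on_subset[OF assms that]])
  have "e \<in> (`) f ` {e. e \<subseteq> S \<and> card e = 2}" if e: "e \<subseteq> f ` S" "card e = 2" for e
  proof -
    obtain d where d: "d \<subseteq> S" "e = f ` d" using e(1) by (rule subset_imageE)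
    with e(2) card have "card d = 2" by metis
    with d show ?thesis by simp
  qed
  moreover have "f ` d \<subseteq> f ` S \<and> card (f ` d) = 2" if "d \<subseteq> S" "card d = 2" for d
    using image_mono[OF that(1)] card[OF that(1)] that(2) by simp
  ultimately show ?thesis by (intro equalityI subsetI) (simp_all, elim imageE, simp)
qed

lemma iso_complete_union_isolated_iff:
  assumes "simple_graph V E" "S \<subseteq> V"
  shows "attach_loops V E S \<cong>\<^sub>l looped_complete (card S) \<union>\<^sub>l isolated_vertices (card V - card S)
    \<longleftrightarrow> E = {e. e \<subseteq> S \<and> card e = 2}"
proof -
  let ?k = "card S" and ?l = "card V - card S"
  let ?pairs = "\<lambda>S. {e. e \<subseteq> S \<and> card e = 2}"
  have fin: "finite V" and E: "E \<subseteq> Pow V"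
    using assms(1) by (auto simp: simple_graph_def)
  have inl: "inj_on Inl {..<?k}" by simp
  \<comment> \<open>The isolated summand contributes neither edges nor loops, so both conditions
    concern only the left copy, which must be the image of \<open>S\<close>.\<close>
  have iso: "attach_loops V E S \<cong>\<^sub>l looped_complete ?k \<union>\<^sub>l isolated_vertices ?l \<longleftrightarrow>
    (\<exists>f. bij_betw f V ({..<?k} <+> {..<?l}) \<and>
      ?pairs (Inl ` {..<?k}) = (`) f ` E \<and> Inl ` {..<?k} = f ` S)"
    unfolding loop_graph_iso_def attach_loops_def looped_complete_def isolated_vertices_def
      loop_graph_union_def image_pairs[OF inl, symmetric]
    by (simp add: Plus_def)
  show ?thesis
  proof
    assume "attach_loops V E S \<cong>\<^sub>l looped_complete ?k \<union>\<^sub>l isolated_vertices ?l"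
    then obtain f where f: "bij_betw f V ({..<?k} <+> {..<?l})"
      "?pairs (f ` S) = (`) f ` E" unfolding iso by auto
    have inj: "inj_on f V" using f(1) by (simp add: bij_betw_def)
    \<comment> \<open>Both edge sets have the same image under \<open>f\<close>; taking images is
      injective on subsets of \<open>Pow V\<close>, so they can be compared before applying
      \<open>f\<close>.\<close>
    have im: "(`) f ` E = (`) f ` ?pairs S"
      using f(2) image_pairs[OF inj_on_subset[OF inj assms(2)]] by simp
    have "?pairs S \<subseteq> Pow V" using assms(2) by auto
    with im show "E = ?pairs S"
      by (simp only: inj_on_image_eq_iff[OF inj_on_image_Pow[OF inj] E])
  next
    assume eq: "E = ?pairs S"
    have finS: "finite S" using assms(2) fin by (rule finite_subset)
    obtain g where g: "bij_betw g S {..<?k}"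
      using finS by (metis atLeast0LessThan ex_bij_betw_finite_nat)
    have "card (V - S) = ?l" using assms(2) finS by (simp add: card_Diff_subset)
    then obtain h where h: "bij_betw h (V - S) {..<?l}"
      using fin by (metis atLeast0LessThan ex_bij_betw_finite_nat finite_Diff)
    \<comment> \<open>Looped vertices are numbered in the left summand and the remaining ones in the
      right summand.\<close>
    define f where "f = (\<lambda>v. if v \<in> S then Inl (g v) else Inr (h v))"
    have fS: "bij_betw f S (Inl ` {..<?k})"
      using g by (auto simp: f_def bij_betw_def inj_on_def)
    moreover have "bij_betw f (V - S) (Inr ` {..<?l})"
      using h by (auto simp: f_def bij_betw_def inj_on_def)
    ultimately have "bij_betw f (S \<union> (V - S)) (Inl ` {..<?k} \<union> Inr ` {..<?l})"
      by (rule bij_betw_combine) auto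
    moreover have "S \<union> (V - S) = V" using assms(2) by auto
    ultimately have "bij_betw f V ({..<?k} <+> {..<?l})" by (simp add: Plus_def)
    moreover have "Inl ` {..<?k} = f ` S" using fS by (simp add: bij_betw_def)
    moreover have "(`) f ` E = ?pairs (f ` S)"
      unfolding eq using fS by (intro image_pairs) (simp add: bij_betw_def)
    ultimately show "attach_loops V E S \<cong>\<^sub>l looped_complete ?k \<union>\<^sub>l isolated_vertices ?l"
      unfolding iso by (intro exI[of _ f]) simp
  qed
qed

lemma iso_looped_complete_iff:
  assumes "simple_graph V E" "S \<subseteq> V"
  shows "attach_loops V E S \<cong>\<^sub>l looped_complete (card V) \<longleftrightarrow> S = V \<and> E = {e. e \<subseteq> V \<and> card e = 2}"
proof -
  let ?pairs = "\<lambda>S. {e. e \<subseteq> S \<and> card e = 2}"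
  have fin: "finite V" and E: "E \<subseteq> Pow V"
    using assms(1) by (auto simp: simple_graph_def)
  have iso: "attach_loops V E S \<cong>\<^sub>l looped_complete (card V) \<longleftrightarrow>
    (\<exists>f. bij_betw f V {..<card V} \<and> ?pairs {..<card V} = (`) f ` E \<and> {..<card V} = f ` S)"
    unfolding loop_graph_iso_def attach_loops_def looped_complete_def by simp
  show ?thesis
  proof
    assume "attach_loops V E S \<cong>\<^sub>l looped_complete (card V)"
    then obtain f where f: "bij_betw f V {..<card V}"
      "?pairs {..<card V} = (`) f ` E" "{..<card V} = f ` S" unfolding iso by auto
    have inj: "inj_on f V" and im: "f ` V = {..<card V}" using f(1) by (auto simp: bij_betw_def)
    have "f ` S = f ` V" using f(3) im by simp
    then have SV: "S = V" using inj assms(2) by (metis inj_on_image_eq_iff subset_refl)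
    have im_pairs: "(`) f ` E = (`) f ` ?pairs V"
      using f(2) image_pairs[OF inj] im by simp
    have "?pairs V \<subseteq> Pow V" by auto
    with im_pairs have "E = ?pairs V"
      by (simp only: inj_on_image_eq_iff[OF inj_on_image_Pow[OF inj] E])
    with SV show "S = V \<and> E = ?pairs V" ..
  next
    assume eq: "S = V \<and> E = ?pairs V"
    obtain f where f: "bij_betw f V {..<card V}"
      using fin by (metis atLeast0LessThan ex_bij_betw_finite_nat)
    then have "(`) f ` E = ?pairs (f ` V)"
      using eq image_pairs[of f V] by (simp add: bij_betw_def)
    then show "attach_loops V E S \<cong>\<^sub>l looped_complete (card V)"
      unfolding iso using f eq by (intro exI[of _ f]) (simp add: bij_betw_def)
  qed
qed

text \<open>An unlooped vertex lies on no edge, so connectedness forbids it next to any other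
  vertex. The excluded case is a single unlooped vertex: it is connected and attains the bound 0,
  yet it is not a looped complete graph.\<close>

lemma connected_complete_part:
  assumes "loop_graph_connected (attach_loops V E S)" "E = {e. e \<subseteq> S \<and> card e = 2}"
    and "S \<subseteq> V" "\<not> (card V = 1 \<and> S = {})"
  shows "S = V"
proof (rule ccontr)
  assume "S \<noteq> V"
  then obtain w where w: "w \<in> V" "w \<notin> S" using assms(3) by auto
  have "V \<noteq> {w}" using assms(3,4) w by auto
  then obtain u where u: "u \<in> V" "u \<noteq> w" using w by auto
  have "(w, u) \<in> {(x, y). {x, y} \<in> E}\<^sup>*"
    using assms(1) u w by (auto simp: loop_graph_connected_def attach_loops_def)
  \<comment> \<open>The first edge of a path from \<open>w\<close> to \<open>u\<close> would contain
    \<open>w\<close>, although all edges lie inside \<open>S\<close>.\<close>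
  then obtain y where "{w, y} \<in> E" using u(2) by (cases rule: converse_rtranclE) auto
  then show False using w(2) assms(2) by auto
qed

theorem theorem7:
  fixes V S :: "'a set" and E :: "'a set set" and vs :: "'a list"
    and n m \<sigma> :: nat and G\<^sub>S :: "'a loop_graph"
  assumes "simple_graph V E"
    and "distinct vs" and "set vs = V"
    and "card V = n" and "n \<ge> 1" and "card E = m"
    and "S \<subseteq> V" and "card S = \<sigma>"
    and "G\<^sub>S = attach_loops V E S"
  shows "adj_eigenvalue vs G\<^sub>S 1 \<le> sqrt (2 * real m + real \<sigma>)
    \<and> (adj_eigenvalue vs G\<^sub>S 1 = sqrt (2 * real m + real \<sigma>)
          \<longleftrightarrow> G\<^sub>S \<cong>\<^sub>l looped_complete \<sigma> \<union>\<^sub>l isolated_vertices (n - \<sigma>))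
    \<and> (loop_graph_connected G\<^sub>S \<and> \<not> (n = 1 \<and> \<sigma> = 0) \<longrightarrow>
         (adj_eigenvalue vs G\<^sub>S 1 = sqrt (2 * real m + real \<sigma>)
          \<longleftrightarrow> G\<^sub>S \<cong>\<^sub>l looped_complete n))"
proof -
  let ?l = "adj_eigenvalue vs G\<^sub>S 1" and ?F = "2 * real m + real \<sigma>"
  let ?complete = "E = {e. e \<subseteq> S \<and> card e = 2}"
  have "vs \<noteq> []" using assms(3-5) by auto
  then have "\<exists>r. eigenvalue (adj_matrix vs G\<^sub>S) r"
    unfolding assms(9) adj_matrix_attach_loops[OF assms(2)]
    using symmetric_real_eigenvalue_ex[OF assms(2), of "adj E S"] adj_commute by metis
  note ev = adj_eigenvalue_1_Max[OF this]
  note le = eigenvalue_attach_loops_square_bound[OF assms(1,7,2,3) ev(1)[unfolded assms(9)],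
      folded assms(9), unfolded assms(6,8)]
  have bound: "?l \<le> sqrt ?F" by (rule real_le_rsqrt[OF le(1)])
  have eq: "?l = sqrt ?F \<longleftrightarrow> ?complete"
  proof
    assume "?l = sqrt ?F"
    then have "?l\<^sup>2 = ?F" by simp
    then show ?complete by (rule le(2))
  next
    assume c: ?complete
    have F: "?F = (real \<sigma>)\<^sup>2"
      using complete_part_card_loops[OF assms(1,7) c] assms(6,8) by simp
    show "?l = sqrt ?F"
    proof (cases "S = {}")
      case True
      \<comment> \<open>Without loops the indicator vector is zero and gives no eigenvalue; instead
        the square of the eigenvalue is at most 0.\<close>
      then have "?F = 0" using F assms(8) by simp
      with le(1) show ?thesis by simp
    next
      case False
      \<comment> \<open>The number of loops is an eigenvalue, hence at most the largest one, while
        by \<open>F\<close> it equals the upper bound.\<close>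
      then have "real \<sigma> \<le> ?l"
        using complete_part_eigenvalue[OF assms(1,7) c False assms(2,3)] ev(2) assms(8,9) by simp
      with bound F show ?thesis by simp
    qed
  qed
  have iso: "G\<^sub>S \<cong>\<^sub>l looped_complete \<sigma> \<union>\<^sub>l isolated_vertices (n - \<sigma>) \<longleftrightarrow> ?complete"
    using iso_complete_union_isolated_iff[OF assms(1,7)] assms(4,8,9) by simp
  have "?complete \<longleftrightarrow> G\<^sub>S \<cong>\<^sub>l looped_complete n"
    if "loop_graph_connected G\<^sub>S" "\<not> (n = 1 \<and> \<sigma> = 0)"
  proof -
    have "\<not> (card V = 1 \<and> S = {})" using that(2) assms(4,8) by auto
    then have "?complete \<Longrightarrow> S = V"
      using connected_complete_part[OF that(1)[unfolded assms(9)]] assms(7) by blast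
    then show ?thesis
      using iso_looped_complete_iff[OF assms(1,7)] assms(4,9) by auto
  qed
  with bound eq iso show ?thesis by blast
qed

end
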